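(* Let $G$ be a tree, let $p>1$ be an integer, and let $H$ be a finite collection of subgraphs of $G$, each consisting of at most $d$ connected components. If $H$ satisfies the $(p,p)$ property, then $\tau^*(H)<(pd)^{\frac{1}{p-1}} + 1$.
   Context: $H$ satisfies the $(p,q)$ property if among any $p$ elements of $H$ some $q$ share a common vertex of $G$. $\tau^*(H)$ is the fractional covering number: the minimum of $\sum_{v}g(v)$ over functions $g:V(G)\to\mathbb{R}_{\ge0}$ with $\sum_{v\in V(h)}g(v)\ge 1$ for every $h\in H$.
   Formalization: The collection H is assumed to have at least p members; otherwise the (p,p) property is vacuous and the bound can fail (three single vertices of a 3-vertex path, d = 1, p = 4: fractional covering number 3 > 4^(1/3)+1). *)

theory Defs
  imports "HOL-Analysis.Infinite_Sum" "Graph_Theory.Digraph_Component"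
begin

text \<open>
  As usual in \<open>Graph_Theory\<close>, an undirected simple graph is a symmetric digraph without loops and
  parallel arcs: an undirected edge is a pair of opposite arcs.  The locale \<^locale>\<open>graph\<close> of that
  library also requires finiteness, which is not assumed here.
\<close>

definition simple_graph :: "('a, 'b) pre_digraph \<Rightarrow> bool" where
  "simple_graph G \<longleftrightarrow> loopfree_digraph G \<and> nomulti_digraph G \<and> sym_digraph G"

text \<open>
  The library's \<^const>\<open>tree\<close> is not usable for this encoding: its cycles are directed, and going back
  and forth along one edge of a symmetric digraph is already a directed cycle (of length 2).  In a
  simple graph, the directed cycles of length at least 3 are exactly the undirected cycles.
\<close>

definition undirected_tree :: "('a, 'b) pre_digraph \<Rightarrow> bool" where
  "undirected_tree G \<longleftrightarrow>
     simple_graph G \<and> Digraph_Component.connected G \<and>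
     \<not> (\<exists>c. pre_digraph.cycle G c \<and> 3 \<le> length c)"

text \<open>
  \<^const>\<open>subgraph\<close> alone would allow to keep only one of the two arcs of an edge.
\<close>

definition undirected_subgraph :: "('a, 'b) pre_digraph \<Rightarrow> ('a, 'b) pre_digraph \<Rightarrow> bool" where
  "undirected_subgraph h G \<longleftrightarrow> subgraph h G \<and> sym_digraph h"

text \<open>
  In a symmetric digraph the strongly connected components are the connected components.
  Finiteness is explicit since \<^const>\<open>card\<close> is 0 on infinite sets.
\<close>

definition at_most_components :: "nat \<Rightarrow> ('a, 'b) pre_digraph \<Rightarrow> bool" where
  "at_most_components d h \<longleftrightarrow>
     finite (pre_digraph.sccs h) \<and> card (pre_digraph.sccs h) \<le> d"

definition pq_property ::
  "nat \<Rightarrow> nat \<Rightarrow> ('a, 'b) pre_digraph \<Rightarrow> ('a, 'b) pre_digraph set \<Rightarrow> bool" where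
  "pq_property p q G H \<longleftrightarrow>
     (\<forall>A. A \<subseteq> H \<and> card A = p \<longrightarrow>
       (\<exists>B. B \<subseteq> A \<and> card B = q \<and> (\<exists>v \<in> verts G. \<forall>h \<in> B. v \<in> verts h)))"

text \<open>
  If \<open>verts G\<close> is finite, summability is automatic and the infinite sums are the ordinary finite
  sums; if \<open>verts G\<close> is infinite, only functions of finite total weight can attain the minimum.
\<close>

definition fractional_cover ::
  "('a, 'b) pre_digraph \<Rightarrow> ('a, 'b) pre_digraph set \<Rightarrow> ('a \<Rightarrow> real) \<Rightarrow> bool" where
  "fractional_cover G H g \<longleftrightarrow>
     (\<forall>v \<in> verts G. 0 \<le> g v) \<and> g summable_on verts G \<and>
     (\<forall>h \<in> H. 1 \<le> (\<Sum>\<^sub>\<infinity>v \<in> verts h. g v))"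

text \<open>
  For a finite collection of nonempty subgraphs the set below is nonempty, bounded below by 0, and
  its infimum is attained, so that it is the minimum.
\<close>

definition fractional_covering_number ::
  "('a, 'b) pre_digraph \<Rightarrow> ('a, 'b) pre_digraph set \<Rightarrow> real" ("\<tau>\<^sup>*") where
  "\<tau>\<^sup>* G H = Inf {(\<Sum>\<^sub>\<infinity>v \<in> verts G. g v) | g. fractional_cover G H g}"

end

theory Submission
  imports Defs
begin

text \<open>
  Let \<open>c = (p d)\<^bsup>1/(p-1)\<^esup>\<close>.  Root the tree and call the vertex of least depth of a component its top.
  If \<open>p\<close> members of \<open>H\<close>, repetitions allowed, share a vertex, then their components at that vertex
  intersect in a subtree whose top is the top of one of them.  Hence, for weights \<open>f > 0\<close> on \<open>H\<close> of
  total \<open>W\<close>, expanding \<open>W\<^sup>p\<close> and charging each \<open>p\<close>-tuple to such a top gives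
  \<open>W\<^sup>p \<le> p d W m\<^bsup>p-1\<^esup>\<close>, where \<open>m\<close> is the largest weight of the members through a single top, so that
  \<open>W \<le> c m\<close>.  Instead of using linear programming duality to turn this into a fractional
  cover, one repeatedly picks a heaviest top and damps the weights of the members through it by
  \<open>exp (-\<eta>)\<close>: the total weight decays so fast that every member is hit often, and the rescaled
  numbers of picks form a cover of total weight arbitrarily close to \<open>c\<close>.
\<close>

section \<open>Weighted counting of tuples\<close>

text \<open>For a fixed position \<open>i\<close> and point \<open>x\<close> the entries of a
  charged tuple vary independently: entry \<open>i\<close> ranges over members with \<open>x\<close>
  in \<open>R h\<close>, and every other entry contributes at most \<open>m\<close>. Summing over
  \<open>x\<close> meets each \<open>h\<close> at most \<open>d\<close> times; the choice of
  \<open>i\<close> costs the factor \<open>p\<close>.\<close>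

lemma weighted_tuple_count:
  fixes V :: "'h \<Rightarrow> 'a set" and f :: "'h \<Rightarrow> real"
  assumes fin: "finite H" and T: "finite T"
    and root_sub: "\<And>h. h \<in> H \<Longrightarrow> R h \<subseteq> T"
    and root_card: "\<And>h. h \<in> H \<Longrightarrow> card (R h) \<le> d"
    and common: "\<And>\<phi>. \<phi> \<in> {..<p} \<rightarrow>\<^sub>E H \<Longrightarrow>
      \<exists>i<p. \<exists>x\<in>R (\<phi> i). \<forall>j<p. x \<in> V (\<phi> j)"
    and f0: "\<And>h. h \<in> H \<Longrightarrow> 0 \<le> f h"
    and m: "\<And>x. x \<in> T \<Longrightarrow> (\<Sum>h | h \<in> H \<and> x \<in> V h. f h) \<le> m"
    and m0: "0 \<le> m"
  shows "(\<Sum>h\<in>H. f h) ^ p \<le> real p * (real d * (\<Sum>h\<in>H. f h)) * m ^ (p - 1)"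
proof -
  \<comment> \<open>For \<open>i < p\<close>, the product of \<open>a i x j (\<phi> j)\<close> over
    \<open>j\<close> is the weight of the tuple if it can be charged to \<open>x\<close> through
    entry \<open>i\<close>, and 0 otherwise.\<close>
  define a where "a i x j h = (if x \<in> V h \<and> (j = i \<longrightarrow> x \<in> R h) then f h else 0)"
    for i j :: nat and x and h
  define r where "r x = (\<Sum>h\<in>H. if x \<in> R h then f h else 0)" for x
  have a0: "0 \<le> a i x j h" if "h \<in> H" for i x j h
    using f0[OF that] by (simp add: a_def)
  have prod_a0: "0 \<le> (\<Prod>j<p. a i x j (\<phi> j))" if "\<phi> \<in> {..<p} \<rightarrow>\<^sub>E H" for i x \<phi>
    using that by (intro prod_nonneg ballI a0) auto
  have r0: "0 \<le> r x" for x
    unfolding r_def by (intro sum_nonneg) (auto simp: f0)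
  have "(\<Sum>h\<in>H. f h) ^ p = (\<Sum>\<phi>\<in>{..<p} \<rightarrow>\<^sub>E H. \<Prod>j<p. f (\<phi> j))"
    using prod_sum_PiE[of "{..<p}" "\<lambda>_. H" "\<lambda>_. f"] fin by simp
  \<comment> \<open>A tuple may be charged several times; all terms are nonnegative, so this only
    enlarges the sum.\<close>
  also have "\<dots> \<le> (\<Sum>\<phi>\<in>{..<p} \<rightarrow>\<^sub>E H. \<Sum>i<p. \<Sum>x\<in>T. \<Prod>j<p. a i x j (\<phi> j))"
  proof (intro sum_mono)
    fix \<phi> assume phi: "\<phi> \<in> {..<p} \<rightarrow>\<^sub>E H"
    from common[OF phi] obtain i x where i: "i < p" and x: "x \<in> R (\<phi> i)"
      and xV: "\<And>j. j < p \<Longrightarrow> x \<in> V (\<phi> j)" by blast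
    have "x \<in> T" using root_sub[of "\<phi> i"] phi i x by auto
    have "(\<Prod>j<p. f (\<phi> j)) = (\<Prod>j<p. a i x j (\<phi> j))"
      using x xV by (intro prod.cong) (auto simp: a_def)
    also have "\<dots> \<le> (\<Sum>x\<in>T. \<Prod>j<p. a i x j (\<phi> j))"
      by (rule member_le_sum[of x T "\<lambda>x. \<Prod>j<p. a i x j (\<phi> j)"])
        (use \<open>x \<in> T\<close> T prod_a0[OF phi] in auto)
    also have "\<dots> \<le> (\<Sum>i<p. \<Sum>x\<in>T. \<Prod>j<p. a i x j (\<phi> j))"
      by (rule member_le_sum[of i "{..<p}" "\<lambda>i. \<Sum>x\<in>T. \<Prod>j<p. a i x j (\<phi> j)"])
        (use i prod_a0[OF phi] in \<open>auto intro!: sum_nonneg\<close>)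
    finally show "(\<Prod>j<p. f (\<phi> j)) \<le> (\<Sum>i<p. \<Sum>x\<in>T. \<Prod>j<p. a i x j (\<phi> j))" .
  qed
  also have "\<dots> = (\<Sum>i<p. \<Sum>x\<in>T. \<Sum>\<phi>\<in>{..<p} \<rightarrow>\<^sub>E H. \<Prod>j<p. a i x j (\<phi> j))"
    by (subst sum.swap, intro sum.cong refl, rule sum.swap)
  \<comment> \<open>Distributivity backwards: with \<open>i\<close> and \<open>x\<close> fixed, the
    sum over tuples factors over the positions.\<close>
  also have "\<dots> = (\<Sum>i<p. \<Sum>x\<in>T. \<Prod>j<p. \<Sum>h\<in>H. a i x j h)"
    using fin by (subst prod_sum_PiE) auto
  also have "\<dots> \<le> (\<Sum>i<p. \<Sum>x\<in>T. r x * m ^ (p - 1))"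
  proof (intro sum_mono)
    fix i x assume i: "i \<in> {..<p}" and x: "x \<in> T"
    have "(\<Prod>j<p. \<Sum>h\<in>H. a i x j h) =
        (\<Sum>h\<in>H. a i x i h) * (\<Prod>j\<in>{..<p} - {i}. \<Sum>h\<in>H. a i x j h)"
      using i by (simp add: prod.remove)
    also have "(\<Prod>j\<in>{..<p} - {i}. \<Sum>h\<in>H. a i x j h) =
        (\<Prod>j\<in>{..<p} - {i}. \<Sum>h | h \<in> H \<and> x \<in> V h. f h)"
      using fin by (intro prod.cong refl) (auto simp: a_def sum.inter_filter)
    also have "\<dots> = (\<Sum>h | h \<in> H \<and> x \<in> V h. f h) ^ (p - 1)"
      using i by simp
    also have "(\<Sum>h\<in>H. a i x i h) * \<dots> \<le> r x * m ^ (p - 1)"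
      unfolding r_def
      by (intro mult_mono sum_mono power_mono m x sum_nonneg zero_le_power)
        (auto simp: a_def f0)
    finally show "(\<Prod>j<p. \<Sum>h\<in>H. a i x j h) \<le> r x * m ^ (p - 1)" .
  qed
  also have "\<dots> = real p * ((\<Sum>x\<in>T. r x) * m ^ (p - 1))"
    by (simp add: sum_distrib_right)
  also have "\<dots> \<le> real p * ((real d * (\<Sum>h\<in>H. f h)) * m ^ (p - 1))"
  proof -
    have "(\<Sum>x\<in>T. r x) = (\<Sum>h\<in>H. \<Sum>x\<in>T. if x \<in> R h then f h else 0)"
      unfolding r_def by (rule sum.swap)
    also have "\<dots> = (\<Sum>h\<in>H. real (card (R h)) * f h)"
    proof (intro sum.cong refl)
      fix h assume "h \<in> H"
      have "{x \<in> T. x \<in> R h} = R h" using root_sub[OF \<open>h \<in> H\<close>] by auto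
      then show "(\<Sum>x\<in>T. if x \<in> R h then f h else 0) = real (card (R h)) * f h"
        using T by (simp flip: sum.inter_filter)
    qed
    also have "\<dots> \<le> (\<Sum>h\<in>H. real d * f h)"
      by (intro sum_mono mult_right_mono) (auto simp: root_card f0)
    also have "\<dots> = real d * (\<Sum>h\<in>H. f h)" by (simp add: sum_distrib_left)
    finally show ?thesis
      using m0 by (intro mult_left_mono mult_right_mono) auto
  qed
  finally show ?thesis by (simp add: mult.assoc)
qed

text \<open>Take \<open>x\<close> in \<open>T\<close> maximizing the weight through it, use that
  weight as \<open>m\<close> in \<open>weighted_tuple_count\<close>, divide by the total and extract
  the root of order \<open>p - 1\<close>.\<close>

lemma exists_heavy_root:
  fixes V :: "'h \<Rightarrow> 'a set" and f :: "'h \<Rightarrow> real"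
  assumes fin: "finite H" "H \<noteq> {}" and p: "p > 1" and T: "finite T"
    and root_sub: "\<And>h. h \<in> H \<Longrightarrow> R h \<subseteq> T"
    and root_card: "\<And>h. h \<in> H \<Longrightarrow> card (R h) \<le> d"
    and common: "\<And>\<phi>. \<phi> \<in> {..<p} \<rightarrow>\<^sub>E H \<Longrightarrow>
      \<exists>i<p. \<exists>x\<in>R (\<phi> i). \<forall>j<p. x \<in> V (\<phi> j)"
    and f0: "\<And>h. h \<in> H \<Longrightarrow> 0 < f h"
  shows "\<exists>x\<in>T. (\<Sum>h\<in>H. f h) \<le> (real p * real d) powr (1 / (real p - 1)) * (\<Sum>h | h \<in> H \<and> x \<in> V h. f h)"
proof -
  define W where "W = (\<Sum>h\<in>H. f h)"
  define s where "s x = (\<Sum>h | h \<in> H \<and> x \<in> V h. f h)" for x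
  have W: "0 < W" unfolding W_def using fin f0 by (intro sum_pos) auto
  have s0: "0 \<le> s x" for x
    unfolding s_def by (intro sum_nonneg) (auto intro: less_imp_le f0)
  from fin obtain h where "h \<in> H" by auto
  \<comment> \<open>A constant tuple already yields a point of \<open>T\<close>, so a maximum over
    \<open>T\<close> exists.\<close>
  then have "(\<lambda>j\<in>{..<p}. h) \<in> {..<p} \<rightarrow>\<^sub>E H" by auto
  from common[OF this] \<open>h \<in> H\<close> root_sub[of h] have "T \<noteq> {}" by auto
  with T obtain x where x: "x \<in> T" and max: "\<And>y. y \<in> T \<Longrightarrow> s y \<le> s x"
    using ex_is_arg_min_if_finite[of T "\<lambda>x. - s x"] by (force simp: is_arg_min_linorder)
  have "W ^ p \<le> real p * (real d * W) * s x ^ (p - 1)"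
    unfolding W_def
    by (rule weighted_tuple_count[of H T R d p V])
      (use assms max s0 in \<open>auto simp: s_def intro: less_imp_le\<close>)
  also have "W ^ p = W * W ^ (p - 1)" using p by (cases p) auto
  finally have "W ^ (p - 1) \<le> (real p * real d) * s x ^ (p - 1)"
    using W by (simp add: ac_simps)
  also have "real p * real d = ((real p * real d) powr (1 / (real p - 1))) ^ (p - 1)"
    (is "?c = ?b ^ _")
  \<comment> \<open>For \<open>?c = 0\<close> both sides vanish, because \<open>0 powr _ = 0\<close>
    and the exponent \<open>p - 1\<close> is positive.\<close>
  proof (cases "?c = 0")
    case False
    have "?b ^ (p - 1) = ?b powr (real p - 1)"
      using p False by (subst powr_realpow[symmetric]) (auto simp: of_nat_diff)
    also have "\<dots> = ?c" using p by (simp add: powr_powr)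
    finally show ?thesis by simp
  qed (use p in auto)
  also have "\<dots> * s x ^ (p - 1) = (?b * s x) ^ (p - 1)" by (simp add: power_mult_distrib)
  finally have "W ^ (p - 1) \<le> (?b * s x) ^ (p - 1)" .
  then have "W \<le> ?b * s x"
    using p W s0 by (subst (asm) power_mono_iff) auto
  then show ?thesis using x unfolding W_def s_def by blast
qed

section \<open>Covers from multiplicative weights\<close>

text \<open>\<open>g\<close> counts the picks of each point, and the sum of exponentials is the
  current total weight. The picked point carries at least a fraction \<open>1 / c\<close> of it, so
  a damping multiplies the total by at most \<open>1 - (1 - exp (- \<eta>)) / c\<close>, which
  \<open>1 + y \<le> exp y\<close> bounds by an exponential.\<close>

lemma multiplicative_weights:
  fixes V :: "'h \<Rightarrow> 'a set" and c \<eta> :: real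
  assumes fin: "finite H" "finite T" and c: "c > 0" and eta: "\<eta> > 0"
    and heavy: "\<And>f :: 'h \<Rightarrow> real. (\<And>h. h \<in> H \<Longrightarrow> 0 < f h) \<Longrightarrow>
      \<exists>x\<in>T. (\<Sum>h\<in>H. f h) \<le> c * (\<Sum>h | h \<in> H \<and> x \<in> V h. f h)"
  shows "\<exists>g :: 'a \<Rightarrow> real. (\<forall>x. 0 \<le> g x) \<and> (\<forall>x. x \<notin> T \<longrightarrow> g x = 0) \<and> sum g T = real n \<and>
    (\<Sum>h\<in>H. exp (- \<eta> * sum g (T \<inter> V h))) \<le> card H * exp (- (real n * (1 - exp (- \<eta>)) / c))"
proof (induction n)
  case 0
  show ?case by (rule exI[of _ "\<lambda>_. 0"]) simp
next
  case (Suc n)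
  then obtain g :: "'a \<Rightarrow> real" where g0: "\<And>x. 0 \<le> g x" and gT: "\<And>x. x \<notin> T \<Longrightarrow> g x = 0"
    and sg: "sum g T = real n"
    and le: "(\<Sum>h\<in>H. exp (- \<eta> * sum g (T \<inter> V h))) \<le> card H * exp (- (real n * (1 - exp (- \<eta>)) / c))"
    by blast
  define f where "f h = exp (- \<eta> * sum g (T \<inter> V h))" for h
  define q where "q = 1 - exp (- \<eta>)"
  obtain x where x: "x \<in> T" and xW: "(\<Sum>h\<in>H. f h) \<le> c * (\<Sum>h | h \<in> H \<and> x \<in> V h. f h)"
    using heavy[of f] by (auto simp: f_def)
  have q: "0 < q" using eta by (simp add: q_def)
  define g' where "g' = g(x := g x + 1)"
  have sum_g': "sum g' S = sum g S + (if x \<in> S then 1 else 0)" if "finite S" for S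
  proof -
    have "sum g' S = (\<Sum>y\<in>S. g y + (if y = x then 1 else 0))"
      by (intro sum.cong) (auto simp: g'_def)
    then show ?thesis using that by (simp add: sum.distrib)
  qed
  have "(\<Sum>h\<in>H. exp (- \<eta> * sum g' (T \<inter> V h))) = (\<Sum>h\<in>H. f h - (if x \<in> V h then q * f h else 0))"
  proof (intro sum.cong refl)
    fix h
    have "exp (- (\<eta> * (sum g (T \<inter> V h) + 1))) = f h * exp (- \<eta>)"
      by (simp add: f_def algebra_simps flip: exp_add)
    then show "exp (- \<eta> * sum g' (T \<inter> V h)) = f h - (if x \<in> V h then q * f h else 0)"
      using fin x by (cases "x \<in> V h") (simp_all add: sum_g' f_def q_def left_diff_distrib mult.commute)
  qed
  also have "\<dots> = (\<Sum>h\<in>H. f h) - q * (\<Sum>h | h \<in> H \<and> x \<in> V h. f h)"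
    using fin by (simp add: sum_subtractf sum_distrib_left flip: sum.inter_filter)
  also have "\<dots> \<le> (\<Sum>h\<in>H. f h) - q * ((\<Sum>h\<in>H. f h) / c)"
    using xW q c by (intro diff_left_mono mult_left_mono) (auto simp: field_simps)
  also have "\<dots> = (\<Sum>h\<in>H. f h) * (1 + (- (q / c)))" by (simp add: algebra_simps)
  also have "\<dots> \<le> (\<Sum>h\<in>H. f h) * exp (- (q / c))"
    by (intro mult_left_mono exp_ge_add_one_self sum_nonneg) (auto simp: f_def)
  also have "\<dots> \<le> (card H * exp (- (real n * q / c))) * exp (- (q / c))"
    using le by (intro mult_right_mono) (auto simp: f_def q_def)
  also have "\<dots> = card H * exp (- (real (Suc n) * q / c))"
    by (simp add: mult.assoc flip: exp_add) (simp add: field_simps add_divide_distrib)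
  finally have "(\<Sum>h\<in>H. exp (- \<eta> * sum g' (T \<inter> V h))) \<le>
      card H * exp (- (real (Suc n) * (1 - exp (- \<eta>)) / c))"
    by (simp only: q_def)
  moreover have "0 \<le> g' y" "y \<notin> T \<longrightarrow> g' y = 0" for y
    using g0[of y] gT[of y] x by (auto simp: g'_def)
  moreover have "sum g' T = real (Suc n)" using sg x fin by (simp add: sum_g')
  ultimately show ?case by blast
qed

text \<open>Each summand is at most the total weight after \<open>n\<close> picks; taking
  logarithms, every member has been hit about \<open>n / c\<close> times, up to the loss of
  \<open>1 - exp (- \<eta>)\<close> against \<open>\<eta>\<close> and the term
  \<open>ln (card H)\<close>. The slack \<open>c' - c\<close> absorbs both, so scaling by
  \<open>c' / n\<close> gives a cover.\<close>

lemma exists_light_cover: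
  fixes V :: "'h \<Rightarrow> 'a set" and c c' :: real
  assumes fin: "finite H" "finite T" and c: "0 < c" "c < c'"
    and heavy: "\<And>f :: 'h \<Rightarrow> real. (\<And>h. h \<in> H \<Longrightarrow> 0 < f h) \<Longrightarrow>
      \<exists>x\<in>T. (\<Sum>h\<in>H. f h) \<le> c * (\<Sum>h | h \<in> H \<and> x \<in> V h. f h)"
  shows "\<exists>g :: 'a \<Rightarrow> real. (\<forall>x. 0 \<le> g x) \<and> (\<forall>x. x \<notin> T \<longrightarrow> g x = 0) \<and> sum g T = c' \<and>
    (\<forall>h\<in>H. 1 \<le> sum g (T \<inter> V h))"
proof (cases "H = {}")
  case True
  \<comment> \<open>Even for empty \<open>H\<close> the hypothesis \<open>heavy\<close> yields a
    point of \<open>T\<close>, which then carries the whole mass.\<close>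
  obtain x where "x \<in> T" using heavy[of "\<lambda>_. 1"] True by auto
  with True fin c show ?thesis
    by (intro exI[of _ "\<lambda>y. if y = x then c' else 0"]) auto
next
  case False
  \<comment> \<open>Chosen so that \<open>1 / (1 + \<eta>) = c / c' + \<delta>\<close>, the midpoint
    between \<open>c / c'\<close> and 1.\<close>
  define \<eta> where "\<eta> = (c' - c) / (c' + c)"
  define \<delta> where "\<delta> = (c' - c) / (2 * c')"
  have eta: "0 < \<eta>" and delta: "0 < \<delta>" using c by (simp_all add: \<eta>_def \<delta>_def)
  have gap: "\<eta> * (c / c' + \<delta>) \<le> 1 - exp (- \<eta>)"
  proof -
    have "1 + \<eta> \<le> exp \<eta>" by (rule exp_ge_add_one_self)
    then have "exp (- \<eta>) \<le> 1 / (1 + \<eta>)"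
      using eta by (simp add: exp_minus field_simps)
    moreover have "1 - 1 / (1 + \<eta>) = \<eta> * (1 / (1 + \<eta>))"
      using eta by (simp add: field_simps)
    moreover have "1 / (1 + \<eta>) = c / c' + \<delta>"
      using c by (simp add: \<eta>_def \<delta>_def divide_simps)
    ultimately show ?thesis by simp
  qed
  \<comment> \<open>Large enough for \<open>n * \<eta> * \<delta> / c\<close> to absorb
    \<open>ln (card H)\<close>; the \<open>+ 1\<close> keeps \<open>n\<close> positive even when the
    logarithm is 0.\<close>
  define n where "n = nat \<lceil>c * ln (card H) / (\<eta> * \<delta>)\<rceil> + 1"
  have n: "0 < n" "c * ln (card H) / (\<eta> * \<delta>) \<le> real n"
    unfolding n_def by linarith+
  obtain g :: "'a \<Rightarrow> real" where g0: "\<And>x. 0 \<le> g x" and gT: "\<And>x. x \<notin> T \<Longrightarrow> g x = 0"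
    and sg: "sum g T = real n"
    and le: "(\<Sum>h\<in>H. exp (- \<eta> * sum g (T \<inter> V h))) \<le> card H * exp (- (real n * (1 - exp (- \<eta>)) / c))"
    using multiplicative_weights[OF fin c(1) eta heavy] by blast
  have "real n / c' \<le> sum g (T \<inter> V h)" if "h \<in> H" for h
  proof -
    have cardH: "0 < real (card H)" using False fin by (simp add: card_gt_0_iff)
    have "exp (- \<eta> * sum g (T \<inter> V h)) \<le> (\<Sum>h\<in>H. exp (- \<eta> * sum g (T \<inter> V h)))"
      by (rule member_le_sum) (use that fin in auto)
    also note le
    also have "card H * exp (- (real n * (1 - exp (- \<eta>)) / c)) =
        exp (ln (card H) - real n * (1 - exp (- \<eta>)) / c)"
      using cardH by (simp add: exp_diff exp_minus field_simps)
    finally have "real n * (1 - exp (- \<eta>)) / c - ln (card H) \<le> \<eta> * sum g (T \<inter> V h)"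
      by simp
    moreover have "real n * (\<eta> * (c / c' + \<delta>)) / c \<le> real n * (1 - exp (- \<eta>)) / c"
      using gap c by (intro divide_right_mono mult_left_mono) auto
    moreover have "real n * (\<eta> * (c / c' + \<delta>)) / c = \<eta> * (real n / c') + real n * \<eta> * \<delta> / c"
      using c by (simp add: field_simps)
    moreover have "ln (card H) \<le> real n * \<eta> * \<delta> / c"
      using n(2) c eta delta by (simp add: field_simps)
    ultimately have "\<eta> * (real n / c') \<le> \<eta> * sum g (T \<inter> V h)" by linarith
    then show ?thesis using eta by (rule mult_left_le_imp_le)
  qed
  then have "1 \<le> sum g (T \<inter> V h) * (c' / real n)" if "h \<in> H" for h
    using that n(1) c by (simp add: field_simps)
  moreover have "sum g T * (c' / real n) = c'" using n(1) by (simp add: sg)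
  ultimately show ?thesis
    using c g0 gT by (intro exI[of _ "\<lambda>x. g x * (c' / real n)"]) (simp only: flip: sum_distrib_right, simp)
qed

section \<open>Subtrees of a rooted tree\<close>

context sym_digraph
begin

definition depth :: "'a \<Rightarrow> 'a \<Rightarrow> nat" where
  "depth r v = (LEAST n. (r, v) \<in> arcs_ends G ^^ n)"

lemma depth_relpow: "r \<rightarrow>\<^sup>* v \<Longrightarrow> (r, v) \<in> arcs_ends G ^^ depth r v"
  unfolding depth_def by (rule LeastI_ex) (auto dest: reachable_rtranclI rtrancl_imp_relpow)

lemma depth_le: "(r, v) \<in> arcs_ends G ^^ n \<Longrightarrow> depth r v \<le> n"
  unfolding depth_def by (rule Least_le)

lemma depth_adj_le:
  assumes "r \<rightarrow>\<^sup>* u" "u \<rightarrow> v"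
  shows "depth r v \<le> Suc (depth r u)"
  using depth_relpow[OF assms(1)] assms(2) by (intro depth_le) auto

lemma depth_self [simp]: "depth r r = 0"
  using depth_le[of r r 0] by simp

lemma depth_eq_0D: "r \<rightarrow>\<^sup>* v \<Longrightarrow> depth r v = 0 \<Longrightarrow> v = r"
  using depth_relpow[of r v] by simp

text \<open>The last vertex before \<open>v\<close> on a shortest walk from \<open>r\<close> to
  \<open>v\<close>.\<close>

lemma exists_parent:
  assumes "r \<rightarrow>\<^sup>* v" "v \<noteq> r"
  obtains w where "v \<rightarrow> w" "r \<rightarrow>\<^sup>* w" "depth r w < depth r v"
proof -
  obtain n where n: "depth r v = Suc n"
    using depth_eq_0D assms by (cases "depth r v") auto
  from depth_relpow[OF assms(1)] obtain w where w: "(r, w) \<in> arcs_ends G ^^ n" "w \<rightarrow> v"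
    unfolding n by auto
  have "r \<rightarrow>\<^sup>* w"
    using w(1) assms(1) by (auto simp: reachable_conv adj_in_verts[OF w(2)] dest: relpow_imp_rtrancl)
  with w depth_le[OF w(1)] n that[of w] show thesis
    by (auto intro: graph_symmetric)
qed

text \<open>Shortest walks from \<^term>\<open>a\<close> and \<^term>\<open>b\<close> to the root avoid \<^term>\<open>u\<close>.\<close>

lemma cycle_if_two_low_neighbours:
  assumes conn: "\<And>v. v \<in> verts G \<Longrightarrow> r \<rightarrow>\<^sup>* v"
    and adj: "u \<rightarrow> a" "u \<rightarrow> b" and ne: "a \<noteq> b" "a \<noteq> u" "b \<noteq> u"
    and low: "depth r a \<le> depth r u" "depth r b \<le> depth r u"
  shows "\<exists>c. cycle c \<and> 3 \<le> length c"
proof -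
  \<comment> \<open>After deleting \<open>u\<close>, a path from \<open>a\<close> to
    \<open>b\<close> that survives closes up with the two edges at \<open>u\<close> to a
    cycle.\<close>
  define H where "H = G \<restriction> (verts G - {u})"
  have wf: "wf_digraph H" unfolding H_def by blast
  have sym: "symmetric H"
    unfolding H_def by (rule induced_graph_imp_symmetric[OF sym_arcs]) auto
  have adjH: "v \<rightarrow>\<^bsub>H\<^esub> w" if "v \<rightarrow> w" "v \<noteq> u" "w \<noteq> u" for v w
    using that adj_in_verts[OF that(1)] unfolding H_def
    by (auto simp: arcs_ends_conv)
  \<comment> \<open>Climbing by \<open>exists_parent\<close>, the depth drops strictly below
    \<open>depth r u\<close>, so \<open>u\<close> is never met.\<close>
  have to_root: "v \<rightarrow>\<^sup>*\<^bsub>H\<^esub> r" if "v \<in> verts G" "v \<noteq> u" "depth r v \<le> depth r u" for v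
    using that
  proof (induction "depth r v" arbitrary: v rule: less_induct)
    case less
    show ?case
    proof (cases "v = r")
      case True
      then show ?thesis using less.prems wf_digraph.reachable_refl[OF wf] by (simp add: H_def)
    next
      case False
      then obtain w where w: "v \<rightarrow> w" "depth r w < depth r v"
        using exists_parent[of r v] conn less.prems by metis
      then have "w \<noteq> u" using less.prems by auto
      then have "w \<rightarrow>\<^sup>*\<^bsub>H\<^esub> r"
        using less.hyps[OF w(2)] less.prems w adj_in_verts[OF w(1)] by auto
      then show ?thesis
        using wf_digraph.adj_reachable_trans[OF wf adjH] w less.prems \<open>w \<noteq> u\<close> by blast
    qed
  qed
  have "a \<rightarrow>\<^sup>*\<^bsub>H\<^esub> b"
    using to_root[of a] to_root[of b] ne low adj adj_in_verts symmetric_reachable[OF sym]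
      wf_digraph.reachable_trans[OF wf] by metis
  then obtain p where pH: "pre_digraph.apath H a p b"
    using wf_digraph.reachable_apath[OF wf] by auto
  have "set (pre_digraph.awalk_verts H a p) \<subseteq> verts H"
    using pH wf_digraph.awalk_conv[OF wf] by (auto simp: pre_digraph.apath_def)
  then have u: "u \<notin> set (awalk_verts a p)"
    using compatible_awalk_verts[OF compatible_induce_subgraph, of G "verts G - {u}"]
    by (auto simp: H_def)
  have p: "apath a p b"
    by (rule subgraph_apath_imp_apath[OF pH]) (auto simp: H_def intro: subgraph_induce_subgraphI)
  \<comment> \<open>Hence the cycle through \<open>u\<close> has at least three arcs.\<close>
  have "p \<noteq> []" using p ne by (auto simp: apath_Nil_iff)
  from adj(1) obtain e where e: "e \<in> arcs G" "tail G e = u" "head G e = a" by (rule reachableE)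
  from graph_symmetric[OF adj(2)] obtain e' where e': "e' \<in> arcs G" "tail G e' = b" "head G e' = u"
    by (rule reachableE)
  have pw: "awalk a p b" "distinct (awalk_verts a p)" "awlast a p = b"
    using p by (auto simp: apath_def)
  have "awalk u (e # p @ [e']) u"
    using e e' pw adj_in_verts adj by (auto simp: awalk_simps)
  moreover have "awalk_verts a (p @ [e']) = awalk_verts a p @ [u]"
    using e' pw(3) \<open>p \<noteq> []\<close> by (simp add: awalk_verts_conv)
  ultimately have "cycle (e # p @ [e'])"
    using pw u e by (auto simp: cycle_def)
  then show ?thesis using \<open>p \<noteq> []\<close> by (intro exI[of _ "e # p @ [e']"]) (cases p; auto)
qed

end

locale rooted_tree = sym_digraph +
  fixes r :: 'a
  assumes loopfree: "\<not> u \<rightarrow> u"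
    and root_reaches: "v \<in> verts G \<Longrightarrow> r \<rightarrow>\<^sup>* v"
    and acyclic: "\<not> (\<exists>c. cycle c \<and> 3 \<le> length c)"
begin

text \<open>Two different such neighbours would produce a cycle by
  \<open>cycle_if_two_low_neighbours\<close>; \<open>loopfree\<close> keeps both distinct from
  \<open>u\<close>.\<close>

lemma low_neighbour_unique:
  assumes "u \<rightarrow> a" "u \<rightarrow> b" "depth r a \<le> depth r u" "depth r b \<le> depth r u"
  shows "a = b"
  using cycle_if_two_low_neighbours[of r u a b] assms root_reaches acyclic loopfree by blast

text \<open>Depths of neighbours differ by at most one. If they were equal, \<open>v\<close> would
  be a second low neighbour of \<open>u\<close> beside its parent, or a loop if \<open>u\<close> is
  the root.\<close>

lemma adj_depth_cases:
  assumes "u \<rightarrow> v"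
  shows "depth r v = Suc (depth r u) \<or> depth r u = Suc (depth r v)"
proof -
  have reach: "r \<rightarrow>\<^sup>* u" "r \<rightarrow>\<^sup>* v" using assms root_reaches adj_in_verts by auto
  have "depth r u \<noteq> depth r v"
  proof
    assume eq: "depth r u = depth r v"
    show False
    proof (cases "u = r")
      case True
      then show False using eq depth_eq_0D[OF reach(2)] assms loopfree by auto
    next
      case False
      then obtain w where "u \<rightarrow> w" "depth r w < depth r u"
        using exists_parent[OF reach(1)] by blast
      then show False using low_neighbour_unique[OF assms, of w] eq by auto
    qed
  qed
  then show ?thesis
    using depth_adj_le[OF reach(1) assms] depth_adj_le[OF reach(2) graph_symmetric[OF assms]]
    by linarith
qed

text \<open>The non-strict inequality matches \<open>low_neighbour_unique\<close>. At
  \<open>r\<close> no such \<open>w\<close> exists and the value is unspecified.\<close>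

definition parent :: "'a \<Rightarrow> 'a" where
  "parent v = (THE w. v \<rightarrow> w \<and> depth r w \<le> depth r v)"

text \<open>Indexed by the depth \<open>k\<close> of the ancestor instead of the number of steps, so
  that adjacent vertices can be compared level by level. Meant for
  \<open>k \<le> depth r v\<close>.\<close>

definition ancestor :: "nat \<Rightarrow> 'a \<Rightarrow> 'a" where
  "ancestor k v = (parent ^^ (depth r v - k)) v"

lemma ancestor_self [simp]: "ancestor (depth r v) v = v"
  by (simp add: ancestor_def)

lemma parent_eq:
  assumes "v \<rightarrow> w" "depth r w \<le> depth r v"
  shows "parent v = w"
  unfolding parent_def using assms low_neighbour_unique by blast

lemma ancestor_up:
  assumes "v \<rightarrow> w" "depth r v = Suc (depth r w)" "k \<le> depth r w"
  shows "ancestor k v = ancestor k w"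
  using assms by (simp add: ancestor_def Suc_diff_le funpow_swap1 parent_eq)

text \<open>One of the two vertices is the parent of the other, so their lines to the root agree
  from the shallower one on.\<close>

lemma ancestor_adj:
  assumes "v \<rightarrow> w" "k \<le> depth r v" "k \<le> depth r w"
  shows "ancestor k v = ancestor k w"
  using adj_depth_cases[OF assms(1)] ancestor_up[OF assms(1)]
    ancestor_up[OF graph_symmetric[OF assms(1)]] assms by auto

text \<open>The climb from \<open>v\<close> to the top \<open>t\<close> stays inside the component.
  Induction along a walk in \<open>h\<close>: for an arc from \<open>x\<close> to \<open>y\<close>,
  an ancestor of \<open>x\<close> is \<open>x\<close> itself or, by \<open>ancestor_adj\<close>, an
  ancestor of \<open>y\<close>.\<close>

lemma ancestors_in_component:
  assumes h: "subgraph h G" "symmetric h" and v: "v \<rightarrow>\<^sup>*\<^bsub>h\<^esub> t"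
    and low: "\<And>x. x \<rightarrow>\<^sup>*\<^bsub>h\<^esub> t \<Longrightarrow> depth r t \<le> depth r x"
  shows "ancestor (depth r t) v = t"
    and "\<lbrakk>depth r t \<le> k; k \<le> depth r v\<rbrakk> \<Longrightarrow> ancestor k v \<rightarrow>\<^sup>*\<^bsub>h\<^esub> t"
proof -
  interpret h: wf_digraph h using h by auto
  have adj: "x \<rightarrow> y" if "x \<rightarrow>\<^bsub>h\<^esub> y" for x y using arcs_ends_mono[OF h(1)] that by auto
  have "ancestor (depth r t) v = t \<and>
      (\<forall>k. depth r t \<le> k \<longrightarrow> k \<le> depth r v \<longrightarrow> ancestor k v \<rightarrow>\<^sup>*\<^bsub>h\<^esub> t)"
    using v
  proof (induction rule: h.converse_reachable_induct)
    case base
    then show ?case by auto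
  next
    case (step x y)
    have xt: "x \<rightarrow>\<^sup>*\<^bsub>h\<^esub> t" using step by (auto intro: h.adj_reachable_trans)
    note xy = adj[OF step(1)]
    have "ancestor k x \<rightarrow>\<^sup>*\<^bsub>h\<^esub> t" if "depth r t \<le> k" "k \<le> depth r x" for k
    proof (cases "k = depth r x")
      case False
      then have "k \<le> depth r y" using that adj_depth_cases[OF xy] by linarith
      then show ?thesis using step that ancestor_adj[OF xy] by simp
    qed (use xt in simp)
    then show ?case using ancestor_adj[OF xy] step low xt by simp
  qed
  then show "ancestor (depth r t) v = t"
    and "\<lbrakk>depth r t \<le> k; k \<le> depth r v\<rbrakk> \<Longrightarrow> ancestor k v \<rightarrow>\<^sup>*\<^bsub>h\<^esub> t" by auto
qed

definition component_top :: "'a set \<Rightarrow> 'a" where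
  "component_top C = (ARG_MIN (depth r) x. x \<in> C)"

definition tops :: "('a, 'b) pre_digraph \<Rightarrow> 'a set" where
  "tops h = component_top ` verts ` pre_digraph.sccs h"

lemma card_tops_le:
  assumes "at_most_components d h"
  shows "finite (tops h)" "card (tops h) \<le> d"
proof -
  show "finite (tops h)" using assms by (auto simp: at_most_components_def tops_def)
  have "card (tops h) \<le> card (pre_digraph.sccs h)"
    unfolding tops_def image_image using assms
    by (intro card_image_le) (simp add: at_most_components_def)
  then show "card (tops h) \<le> d" using assms by (simp add: at_most_components_def)
qed

text \<open>Describes the component of \<open>v\<close> by reachability, in the form that
  \<open>ancestors_in_component\<close> expects. By symmetry, reachability in one direction already
  determines the strong component.\<close>

lemma exists_top:
  assumes h: "subgraph h G" "symmetric h" and v: "v \<in> verts h"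
  obtains t where "t \<in> tops h" "v \<rightarrow>\<^sup>*\<^bsub>h\<^esub> t" "\<And>x. x \<rightarrow>\<^sup>*\<^bsub>h\<^esub> t \<Longrightarrow> depth r t \<le> depth r x"
proof -
  interpret h: wf_digraph h using h by auto
  define C where "C = h.scc_of v"
  have C: "C = {x. v \<rightarrow>\<^sup>*\<^bsub>h\<^esub> x}"
    unfolding C_def h.scc_of_def using symmetric_reachable[OF h(2)] by auto
  have "C \<in> verts ` h.sccs"
    using h.scc_of_in_sccs_verts[OF v] h.sccs_verts_conv by (simp add: C_def)
  then have top: "component_top C \<in> tops h" by (auto simp: tops_def)
  have "v \<in> C" using v by (simp add: C)
  then have min: "component_top C \<in> C" "\<And>x. x \<in> C \<Longrightarrow> depth r (component_top C) \<le> depth r x"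
    unfolding component_top_def
    using arg_min_nat_lemma[of "\<lambda>x. x \<in> C" v "depth r"] by auto
  show thesis
  proof (rule that[OF top])
    show "v \<rightarrow>\<^sup>*\<^bsub>h\<^esub> component_top C" using min(1) by (simp add: C)
    fix x assume "x \<rightarrow>\<^sup>*\<^bsub>h\<^esub> component_top C"
    then have "x \<in> C"
      using min(1) symmetric_reachable[OF h(2)] h.reachable_trans unfolding C by blast
    then show "depth r (component_top C) \<le> depth r x" by (rule min(2))
  qed
qed

text \<open>The intersection of the components containing \<^term>\<open>v\<close> is again a subtree, and its top is
  the deepest of the tops of these components.\<close>

lemma common_vertex_is_top:
  assumes J: "finite J" "J \<noteq> {}"
    and h: "\<And>j. j \<in> J \<Longrightarrow> subgraph (h j) G" "\<And>j. j \<in> J \<Longrightarrow> symmetric (h j)"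
    and v: "\<And>j. j \<in> J \<Longrightarrow> v \<in> verts (h j)"
  shows "\<exists>i\<in>J. \<exists>t\<in>tops (h i). \<forall>j\<in>J. t \<in> verts (h j)"
proof -
  have "\<forall>j\<in>J. \<exists>t. t \<in> tops (h j) \<and> v \<rightarrow>\<^sup>*\<^bsub>h j\<^esub> t \<and> (\<forall>x. x \<rightarrow>\<^sup>*\<^bsub>h j\<^esub> t \<longrightarrow> depth r t \<le> depth r x)"
    using exists_top[OF h v] by metis
  then obtain t where t: "\<And>j. j \<in> J \<Longrightarrow> t j \<in> tops (h j)" "\<And>j. j \<in> J \<Longrightarrow> v \<rightarrow>\<^sup>*\<^bsub>h j\<^esub> t j"
    "\<And>j x. j \<in> J \<Longrightarrow> x \<rightarrow>\<^sup>*\<^bsub>h j\<^esub> t j \<Longrightarrow> depth r (t j) \<le> depth r x"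
    by metis
  \<comment> \<open>The deepest top; negating the depth turns the minimum into a maximum.\<close>
  obtain i where i: "i \<in> J" "\<And>j. j \<in> J \<Longrightarrow> depth r (t j) \<le> depth r (t i)"
    using ex_is_arg_min_if_finite[OF J, of "\<lambda>j. - int (depth r (t j))"]
    by (force simp: is_arg_min_linorder)
  \<comment> \<open>\<open>t i\<close> is an ancestor of \<open>v\<close> at a level between those
    of \<open>t j\<close> and \<open>v\<close>, hence lies in the component of
    \<open>h j\<close>.\<close>
  have "t i \<in> verts (h j)" if j: "j \<in> J" for j
  proof -
    have "ancestor (depth r (t i)) v = t i"
      by (rule ancestors_in_component(1)[OF h[OF i(1)]]) (use t i in auto)
    moreover have "ancestor (depth r (t i)) v \<rightarrow>\<^sup>*\<^bsub>h j\<^esub> t j"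
      by (rule ancestors_in_component(2)[OF h[OF j]]) (use t i j in auto)
    ultimately show ?thesis by (auto elim: reachable_in_vertsE)
  qed
  with t i show ?thesis by blast
qed

end

lemma undirected_tree_imp_rooted_tree:
  assumes "undirected_tree G"
  obtains r where "rooted_tree G r"
proof -
  from assms interpret sym_digraph G by (simp add: undirected_tree_def simple_graph_def)
  from assms interpret loopfree_digraph G by (simp add: undirected_tree_def simple_graph_def)
  have sc: "strongly_connected (mk_symmetric G)"
    using assms by (simp add: undirected_tree_def connected_def)
  \<comment> \<open>Any vertex can serve as root; strong connectedness includes
    nonemptiness.\<close>
  then obtain r where r: "r \<in> verts G" by (auto simp: strongly_connected_def)
  have "rooted_tree G r"
  proof
    show "(u, u) \<notin> arcs_ends G" for u using adj_not_same by auto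
    show "r \<rightarrow>\<^sup>*\<^bsub>G\<^esub> v" if "v \<in> verts G" for v
      using sc r that reachable_mk_symmetric_eq[OF sym_arcs] by (auto simp: strongly_connected_def)
    show "\<not> (\<exists>c. cycle c \<and> 3 \<le> length c)" using assms by (simp add: undirected_tree_def)
  qed
  then show thesis by (rule that)
qed

section \<open>Fractional covers\<close>

text \<open>A tuple with repetitions has fewer than \<open>p\<close> distinct entries; these are
  first completed to a \<open>p\<close>-element subset of \<open>H\<close>. For \<open>q = p\<close>
  the subset given by the property is the whole set.\<close>

lemma pq_property_common_vertex:
  assumes "pq_property p p G H" "finite H" "card H \<ge> p"
    and K: "K \<subseteq> H" "card K \<le> p"
  shows "\<exists>v\<in>verts G. \<forall>h\<in>K. v \<in> verts h"
proof -
  obtain A where A: "K \<subseteq> A" "A \<subseteq> H" "card A = p"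
    using exists_subset_between[of K p H] assms by auto
  have "\<exists>B. B \<subseteq> A \<and> card B = p \<and> (\<exists>v\<in>verts G. \<forall>h\<in>B. v \<in> verts h)"
    using assms(1) A(2,3) unfolding pq_property_def by simp
  then obtain B v where B: "B \<subseteq> A" "card B = p" "v \<in> verts G" "\<forall>h\<in>B. v \<in> verts h"
    by auto
  have "B = A"
    using A B assms(2) by (intro card_subset_eq) (auto intro: finite_subset)
  with A B show ?thesis by blast
qed

lemma fractional_covering_number_le:
  assumes "fractional_cover G H g"
  shows "\<tau>\<^sup>* G H \<le> (\<Sum>\<^sub>\<infinity>v\<in>verts G. g v)"
  unfolding fractional_covering_number_def
proof (rule cInf_lower)
  show "bdd_below {\<Sum>\<^sub>\<infinity>v\<in>verts G. g v |g. fractional_cover G H g}"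
    by (rule bdd_belowI[of _ 0]) (auto simp: fractional_cover_def intro: infsum_nonneg)
qed (use assms in blast)

text \<open>Reduces the infinite sums in \<open>fractional_cover\<close> to finite ones for weights
  living on the finite set of tops.\<close>

lemma infsum_finite_support:
  fixes g :: "'a \<Rightarrow> real"
  assumes "finite T" "\<And>x. x \<notin> T \<Longrightarrow> g x = 0"
  shows "g summable_on S" "infsum g S = sum g (T \<inter> S)"
proof -
  show "g summable_on S"
    using summable_on_cong_neutral[of "T \<inter> S" S g g] assms by auto
  show "infsum g S = sum g (T \<inter> S)"
    using infsum_cong_neutral[of "T \<inter> S" S g g] assms by auto
qed

theorem theorem5p1:
  fixes G :: "('a, 'b) pre_digraph" and H :: "('a, 'b) pre_digraph set" and p d :: nat
  assumes "undirected_tree G"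
    and "p > 1"
    and "finite H"
    and "\<And>h. h \<in> H \<Longrightarrow> undirected_subgraph h G"
    and "\<And>h. h \<in> H \<Longrightarrow> at_most_components d h"
    and "card H \<ge> p"
    and "pq_property p p G H"
  shows "\<tau>\<^sup>* G H < (real p * real d) powr (1 / (real p - 1)) + 1"
proof -
  obtain r where "rooted_tree G r" using undirected_tree_imp_rooted_tree[OF assms(1)] .
  then interpret rooted_tree G r .
  define c where "c = (real p * real d) powr (1 / (real p - 1))"
  define T where "T = (\<Union>h\<in>H. tops h)"
  have H: "H \<noteq> {}" using assms(2,6) by auto
  have sub: "subgraph h G" "symmetric h" if "h \<in> H" for h
    using assms(4)[OF that] by (auto simp: undirected_subgraph_def sym_digraph_def sym_digraph_axioms_def)
  have T: "finite T" using assms(3,5) card_tops_le(1) by (auto simp: T_def)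
  have common: "\<exists>i<p. \<exists>x\<in>tops (\<phi> i). \<forall>j<p. x \<in> verts (\<phi> j)"
    if phi: "\<phi> \<in> {..<p} \<rightarrow>\<^sub>E H" for \<phi>
  proof -
    have "card (\<phi> ` {..<p}) \<le> p" using card_image_le[of "{..<p}" \<phi>] by simp
    then obtain v where "\<And>j. j < p \<Longrightarrow> v \<in> verts (\<phi> j)"
      using pq_property_common_vertex[OF assms(7,3,6), of "\<phi> ` {..<p}"] phi by auto
    moreover have "\<phi> j \<in> H" if "j < p" for j using phi that by auto
    ultimately have "\<exists>i\<in>{..<p}. \<exists>x\<in>tops (\<phi> i). \<forall>j\<in>{..<p}. x \<in> verts (\<phi> j)"
      by (intro common_vertex_is_top sub) (use assms(2) in \<open>auto simp: lessThan_empty_iff\<close>)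
    then show ?thesis by (simp add: Bex_def Ball_def)
  qed
  have heavy: "\<exists>x\<in>T. (\<Sum>h\<in>H. f h) \<le> c * (\<Sum>h | h \<in> H \<and> x \<in> verts h. f h)"
    if "\<And>h. h \<in> H \<Longrightarrow> 0 < f h" for f :: "('a, 'b) pre_digraph \<Rightarrow> real"
    unfolding c_def
    by (rule exists_heavy_root[of H p T tops d verts])
      (use assms(2,3,5) H T that common card_tops_le(2) in \<open>auto simp: T_def\<close>)
  \<comment> \<open>With unit weights, \<open>c = 0\<close> would force
    \<open>card H \<le> 0\<close>; this settles the case \<open>d = 0\<close>.\<close>
  have "c \<noteq> 0"
    using heavy[of "\<lambda>_. 1"] H assms(3) by auto
  then have c: "0 < c" by (simp add: c_def)
  \<comment> \<open>Covers exist for every total above \<open>c\<close>; \<open>c + 1 / 2\<close>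
    leaves room for the strict inequality.\<close>
  have "\<exists>g. (\<forall>x. 0 \<le> g x) \<and> (\<forall>x. x \<notin> T \<longrightarrow> g x = 0) \<and> sum g T = c + 1 / 2 \<and>
      (\<forall>h\<in>H. 1 \<le> sum g (T \<inter> verts h))"
    by (rule exists_light_cover[OF assms(3) T c _ heavy]) simp_all
  then obtain g :: "'a \<Rightarrow> real" where g0: "\<And>x. 0 \<le> g x" and gT: "\<And>x. x \<notin> T \<Longrightarrow> g x = 0"
    and total: "sum g T = c + 1 / 2" and cover: "\<And>h. h \<in> H \<Longrightarrow> 1 \<le> sum g (T \<inter> verts h)"
    by blast
  have "fractional_cover G H g"
    using g0 cover T gT by (simp add: fractional_cover_def infsum_finite_support)
  from fractional_covering_number_le[OF this]
  have "\<tau>\<^sup>* G H \<le> sum g (T \<inter> verts G)"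
    using T gT by (simp add: infsum_finite_support)
  \<comment> \<open>Restricting a nonnegative weight to \<open>verts G\<close> cannot raise its
    sum.\<close>
  also have "\<dots> \<le> sum g T" using T g0 by (intro sum_mono2) auto
  also have "\<dots> < c + 1" by (simp add: total)
  finally show ?thesis by (simp add: c_def)
qed

end
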